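(* Let $k=2^{m}p^{n}$, where $p$ is an odd prime and $m\ge 0$, $n\ge 0$ are integers, and let $D$ be a square-free positive integer. Suppose that $(t(x),r(x),q(x))$ is a cyclotomic family of elliptic curves with $r(x)=\Phi_{k}(x)$, embedding degree $k$ and CM discriminant $D$. Then $\rho(t,r,q)=\deg q(x)/\deg r(x)\ne 1$.
   Context: $\Phi_k(x)$ denotes the $k$-th cyclotomic polynomial. A polynomial $f(x)\in\mathbb{Q}[x]$ represents integers if $f(x_0)\in\mathbb{Z}$ for some $x_0\in\mathbb{Z}$; it represents primes if it is non-constant, irreducible, with positive leading coefficient, represents integers, and $\gcd\{f(x_0)\in\mathbb{Z}: x_0\in\mathbb{Z}\}=1$. For a positive integer $k$ and square-free positive integer $D$, a triple $(t(x),r(x),q(x))\in\mathbb{Q}[x]^3$ parameterizes a complete family of elliptic curves with embedding degree $k$ and CM discriminant $D$ if: $q(x)$ is a power of a polynomial representing primes; $r(x)$ represents primes and $t(x)$ represents integers; $r(x)\mid q(x)+1-t(x)$ and $r(x)\mid \Phi_k(t(x)-1)$; and there is $y(x)\in\mathbb{Q}[x]$ representing integers with $4q(x)=t(x)^2+Dy(x)^2$. A cyclotomic family with $r(x)=\Phi_k(x)$, embedding degree $k$ and CM discriminant $D$ is a complete family obtained by the following (Brezing–Weng) construction: the field $K=\mathbb{Q}[x]/(\Phi_k(x))$ contains $\sqrt{-D}$; choose a primitive $k$-th root of unity $\eta_k\in K$; let $t(x)\in\mathbb{Q}[x]$ with $\deg t<\deg\Phi_k$ map to $\eta_k+1$ in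 $K$; let $y(x)\in\mathbb{Q}[x]$ with $\deg y<\deg \Phi_k$ map to $(\eta_k-1)/\sqrt{-D}$ in $K$; put $q(x)=(t(x)^2+Dy(x)^2)/4$; and require that $q(x)$ represents primes and that $t(x)$ and $y(x)$ represent integers. *)

theory Defs
  imports
    Complex_Main
    "HOL-Computational_Algebra.Computational_Algebra"
    "HOL-Algebra.QuotRing"
begin

section \<open>Cyclotomic polynomials\<close>

definition complex_primitive_roots :: "nat \<Rightarrow> complex set" where
  "complex_primitive_roots k = {z. z ^ k = 1 \<and> (\<forall>j. 0 < j \<and> j < k \<longrightarrow> z ^ j \<noteq> 1)}"

text \<open>The product over the primitive roots of unity lives in \<open>\<complex>[x]\<close>; the descent to
  \<open>\<rat>[x]\<close> is justified by \<open>map_poly_of_rat_cyclotomic_poly\<close> below.\<close>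

definition cyclotomic_poly :: "nat \<Rightarrow> rat poly" where
  "cyclotomic_poly k =
     (THE f. map_poly of_rat f = (\<Prod>z\<in>complex_primitive_roots k. [:- z, 1:]))"

lemma coeff_map_poly_of_rat [simp]:
  "coeff (map_poly (of_rat :: rat \<Rightarrow> complex) f) n = of_rat (coeff f n)"
  by (simp add: coeff_map_poly)

lemma map_poly_of_rat_mult:
  "map_poly (of_rat :: rat \<Rightarrow> complex) (f * g) = map_poly of_rat f * map_poly of_rat g"
  by (rule poly_eqI) (simp add: coeff_mult of_rat_sum of_rat_mult)

lemma map_poly_of_rat_add:
  "map_poly (of_rat :: rat \<Rightarrow> complex) (f + g) = map_poly of_rat f + map_poly of_rat g"
  by (rule poly_eqI) (simp add: of_rat_add)

lemma degree_map_poly_of_rat [simp]: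
  "degree (map_poly (of_rat :: rat \<Rightarrow> complex) f) = degree f"
  by (rule degree_map_poly) simp

lemma map_poly_of_rat_inj:
  "map_poly (of_rat :: rat \<Rightarrow> complex) f = map_poly of_rat g \<Longrightarrow> f = g"
  by (metis coeff_map_poly_of_rat of_rat_eq_iff poly_eqI)

lemma map_poly_of_rat_prod:
  "map_poly (of_rat :: rat \<Rightarrow> complex) (\<Prod>i\<in>A. f i) = (\<Prod>i\<in>A. map_poly of_rat (f i))"
  by (induction A rule: infinite_finite_induct) (simp_all add: map_poly_of_rat_mult)

lemma prod_roots_unity:
  assumes "k > 0"
  shows "(\<Prod>z | z ^ k = 1. [:- z, 1:]) = (monom 1 k - 1 :: complex poly)"
proof -
  let ?f = "monom 1 k - 1 :: complex poly"
  have "rsquarefree ?f"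
    using assms
    by (auto simp: rsquarefree_roots poly_monom pderiv_diff pderiv_monom power_0_left split: if_splits)
  then have "smult (lead_coeff ?f) (\<Prod>z | poly ?f z = 0. [:- z, 1:]) = ?f"
    by (rule complex_poly_decompose_rsquarefree)
  moreover have "degree ?f = k"
  proof (rule antisym)
    show "degree ?f \<le> k"
      by (intro degree_diff_le degree_monom_le) simp
    show "k \<le> degree ?f"
      using assms by (intro le_degree) (simp add: coeff_1)
  qed
  ultimately show ?thesis
    using assms by (simp add: poly_monom coeff_1)
qed

lemma roots_unity_eq_Union:
  assumes "k > 0"
  shows "{z :: complex. z ^ k = 1} = (\<Union>d\<in>{d. d dvd k}. complex_primitive_roots d)"
proof (intro equalityI subsetI)
  fix z :: complex
  assume "z \<in> {z. z ^ k = 1}"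
  then have z: "z ^ k = 1" by simp
  define d where "d = (LEAST j. 0 < j \<and> z ^ j = 1)"
  have d: "0 < d \<and> z ^ d = 1"
    unfolding d_def by (rule LeastI[of _ k]) (use assms z in simp)
  have least: "z ^ j \<noteq> 1" if "0 < j" "j < d" for j
    using not_less_Least[of j "\<lambda>j. 0 < j \<and> z ^ j = 1"] that unfolding d_def by auto
  have "z ^ k = (z ^ d) ^ (k div d) * z ^ (k mod d)"
    by (metis mult_div_mod_eq power_add power_mult)
  then have "z ^ (k mod d) = 1"
    using z d by simp
  then have "d dvd k"
    using least[of "k mod d"] d by (auto simp: dvd_eq_mod_eq_0)
  then show "z \<in> (\<Union>d\<in>{d. d dvd k}. complex_primitive_roots d)"
    using d least by (auto simp: complex_primitive_roots_def)
next
  fix z :: complex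
  assume "z \<in> (\<Union>d\<in>{d. d dvd k}. complex_primitive_roots d)"
  then show "z \<in> {z. z ^ k = 1}"
    by (auto simp: complex_primitive_roots_def dvd_def power_mult)
qed

lemma complex_primitive_roots_disjoint:
  assumes "0 < c" "0 < d" "c \<noteq> d"
  shows "complex_primitive_roots c \<inter> complex_primitive_roots d = {}"
  using assms by (auto simp: complex_primitive_roots_def) (metis linorder_neqE_nat)

lemma finite_complex_primitive_roots:
  "k > 0 \<Longrightarrow> finite (complex_primitive_roots k)"
  by (rule finite_subset[OF _ finite_roots_unity[of k]]) (auto simp: complex_primitive_roots_def)

lemma prod_complex_primitive_roots:
  assumes "k > 0"
  shows "(\<Prod>d | d dvd k. \<Prod>z\<in>complex_primitive_roots d. [:- z, 1:]) = (monom 1 k - 1 :: complex poly)"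
proof -
  have "finite {d. d dvd k}" using assms by simp
  moreover have "d > 0" if "d dvd k" for d
    using assms that by (auto intro: dvd_pos_nat)
  ultimately have "(\<Prod>z\<in>(\<Union>d\<in>{d. d dvd k}. complex_primitive_roots d). [:- z, 1:])
      = (\<Prod>d | d dvd k. \<Prod>z\<in>complex_primitive_roots d. [:- z, 1:])"
    by (intro prod.UNION_disjoint)
      (auto simp: finite_complex_primitive_roots complex_primitive_roots_disjoint)
  then show ?thesis
    using prod_roots_unity[OF assms] roots_unity_eq_Union[OF assms] by simp
qed

lemma cyclotomic_poly_exists:
  "k > 0 \<Longrightarrow> \<exists>f. map_poly of_rat f = (\<Prod>z\<in>complex_primitive_roots k. [:- z, 1:])"
proof (induction k rule: less_induct)
  case (less k)
  define P where "P d = (\<Prod>z\<in>complex_primitive_roots d. [:- z, 1:])" for d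
  define S where "S = {d. d dvd k} - {k}"
  have "finite S" using less.prems by (simp add: S_def)
  have "\<exists>f. map_poly of_rat f = P d" if "d \<in> S" for d
  proof -
    have "d dvd k" "d \<noteq> k" using that by (auto simp: S_def)
    then have "d < k" "d > 0"
      using less.prems dvd_imp_le[of d k] dvd_pos_nat[of k d] by auto
    then show ?thesis using less.IH unfolding P_def by blast
  qed
  then obtain F where F: "\<And>d. d \<in> S \<Longrightarrow> map_poly of_rat (F d) = P d" by metis
  define Q where "Q = prod F S"
  have Q: "map_poly of_rat Q = prod P S"
    using F by (simp add: Q_def map_poly_of_rat_prod)
  have "prod P S \<noteq> 0"
  proof -
    have "(\<Prod>z\<in>A. [:- z, 1 :: complex:]) \<noteq> 0" for A
      by (induction A rule: infinite_finite_induct) (simp_all del: mult_pCons_left)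
    then show ?thesis
      using \<open>finite S\<close> by (simp add: P_def)
  qed
  then have Q0: "Q \<noteq> 0" using Q by auto
  define X where "X = (monom 1 k - 1 :: rat poly)"
  have X: "map_poly of_rat X = (monom 1 k - 1 :: complex poly)"
    by (rule poly_eqI) (simp add: X_def of_rat_diff coeff_1)
  have "(\<Prod>d | d dvd k. P d) = P k * prod P S"
    unfolding S_def using less.prems by (intro prod.remove) auto
  then have "map_poly of_rat X = P k * map_poly of_rat Q"
    using prod_complex_primitive_roots[OF less.prems] Q X by (simp add: P_def)
  moreover have "map_poly (of_rat :: rat \<Rightarrow> complex) X
      = map_poly of_rat Q * map_poly of_rat (X div Q) + map_poly of_rat (X mod Q)"
    by (metis map_poly_of_rat_add map_poly_of_rat_mult mult_div_mod_eq)
  ultimately have eq: "map_poly of_rat (X mod Q)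
      = map_poly of_rat Q * (P k - map_poly of_rat (X div Q))"
    by (simp add: algebra_simps)
  have "P k - map_poly of_rat (X div Q) = 0"
  proof (rule ccontr)
    assume nz: "P k - map_poly of_rat (X div Q) \<noteq> 0"
    have Qc: "map_poly (of_rat :: rat \<Rightarrow> complex) Q \<noteq> 0"
      using Q \<open>prod P S \<noteq> 0\<close> by simp
    have "degree (X mod Q) = degree Q + degree (P k - map_poly of_rat (X div Q))"
      using arg_cong[OF eq, of degree] degree_mult_eq[OF Qc nz] by simp
    moreover have "X mod Q \<noteq> 0"
      using eq Qc nz by auto
    ultimately show False
      using degree_mod_less'[OF Q0, of X] by linarith
  qed
  then show ?case unfolding P_def by (intro exI[of _ "X div Q"]) simp
qed

lemma map_poly_of_rat_cyclotomic_poly: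
  assumes "k > 0"
  shows "map_poly of_rat (cyclotomic_poly k) = (\<Prod>z\<in>complex_primitive_roots k. [:- z, 1:])"
  unfolding cyclotomic_poly_def
proof (rule theI')
  obtain f where f: "map_poly of_rat f = (\<Prod>z\<in>complex_primitive_roots k. [:- z, 1:])"
    using cyclotomic_poly_exists[OF assms] by blast
  show "\<exists>!f. map_poly of_rat f = (\<Prod>z\<in>complex_primitive_roots k. [:- z, 1:])"
    using f by (intro ex1I[of _ f]) (simp_all add: map_poly_of_rat_inj)
qed


section \<open>Polynomials representing integers and primes\<close>

definition represents_integers :: "rat poly \<Rightarrow> bool" where
  "represents_integers f \<longleftrightarrow> (\<exists>x :: int. poly f (of_int x) \<in> \<int>)"

definition represents_primes :: "rat poly \<Rightarrow> bool" where
  "represents_primes f \<longleftrightarrow>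
     degree f > 0 \<and> irreducible f \<and> lead_coeff f > 0 \<and> represents_integers f \<and>
     Gcd {n :: int. \<exists>x :: int. poly f (of_int x) = of_int n} = 1"


section \<open>Complete families of elliptic curves\<close>

definition complete_family ::
  "nat \<Rightarrow> nat \<Rightarrow> rat poly \<Rightarrow> rat poly \<Rightarrow> rat poly \<Rightarrow> bool" where
  "complete_family k D t r q \<longleftrightarrow>
     k > 0 \<and> D > 0 \<and> squarefree D \<and>
     (\<exists>f e. e > 0 \<and> represents_primes f \<and> q = f ^ e) \<and>
     represents_primes r \<and> represents_integers t \<and>
     r dvd q + 1 - t \<and>
     r dvd pcompose (cyclotomic_poly k) (t - 1) \<and>
     (\<exists>y. represents_integers y \<and> 4 * q = t\<^sup>2 + of_nat D * y\<^sup>2)"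


section \<open>The Brezing--Weng construction over a cyclotomic field\<close>

definition rat_poly_ring :: "rat poly ring" where
  "rat_poly_ring = \<lparr>carrier = UNIV, mult = (*), one = 1, zero = 0, add = (+)\<rparr>"

definition cyclotomic_ideal :: "nat \<Rightarrow> rat poly set" where
  "cyclotomic_ideal k = PIdl\<^bsub>rat_poly_ring\<^esub> (cyclotomic_poly k)"

definition cyclotomic_field :: "nat \<Rightarrow> rat poly set ring" where
  "cyclotomic_field k = rat_poly_ring Quot cyclotomic_ideal k"

definition residue_class :: "nat \<Rightarrow> rat poly \<Rightarrow> rat poly set" where
  "residue_class k f = cyclotomic_ideal k +>\<^bsub>rat_poly_ring\<^esub> f"

definition primitive_root_of_unity :: "('a, 'b) monoid_scheme \<Rightarrow> nat \<Rightarrow> 'a \<Rightarrow> bool" where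
  "primitive_root_of_unity K k x \<longleftrightarrow>
     x \<in> carrier K \<and> x [^]\<^bsub>K\<^esub> k = \<one>\<^bsub>K\<^esub> \<and>
     (\<forall>j :: nat. 0 < j \<and> j < k \<longrightarrow> x [^]\<^bsub>K\<^esub> j \<noteq> \<one>\<^bsub>K\<^esub>)"

text \<open>The element \<open>s\<close> is a choice of \<open>\<surd>(-D)\<close> in \<open>K = \<rat>[x]/(\<Phi>\<^sub>k)\<close>.\<close>

definition brezing_weng ::
  "nat \<Rightarrow> nat \<Rightarrow> rat poly set \<Rightarrow> rat poly set \<Rightarrow>
     rat poly \<Rightarrow> rat poly \<Rightarrow> rat poly \<Rightarrow> bool" where
  "brezing_weng k D \<eta> s t y q \<longleftrightarrow>
     (let K = cyclotomic_field k in
        s \<in> carrier K \<and> s \<otimes>\<^bsub>K\<^esub> s = residue_class k (- of_nat D) \<and>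
        primitive_root_of_unity K k \<eta> \<and>
        degree t < degree (cyclotomic_poly k) \<and>
        residue_class k t = \<eta> \<oplus>\<^bsub>K\<^esub> \<one>\<^bsub>K\<^esub> \<and>
        degree y < degree (cyclotomic_poly k) \<and>
        residue_class k y = (\<eta> \<ominus>\<^bsub>K\<^esub> \<one>\<^bsub>K\<^esub>) \<otimes>\<^bsub>K\<^esub> inv\<^bsub>K\<^esub> s \<and>
        q = smult (1 / 4) (t\<^sup>2 + of_nat D * y\<^sup>2) \<and>
        represents_primes q \<and> represents_integers t \<and> represents_integers y)"

definition cyclotomic_family ::
  "nat \<Rightarrow> nat \<Rightarrow> rat poly \<Rightarrow> rat poly \<Rightarrow> rat poly \<Rightarrow> bool" where
  "cyclotomic_family k D t r q \<longleftrightarrow>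
     complete_family k D t r q \<and> r = cyclotomic_poly k \<and>
     (\<exists>\<eta> s y. brezing_weng k D \<eta> s t y q)"

definition rho_value :: "rat poly \<Rightarrow> rat poly \<Rightarrow> rat poly \<Rightarrow> rat" where
  "rho_value t r q = of_nat (degree q) / of_nat (degree r)"

end

theory Submission
  imports
    Defs
    "HOL-Computational_Algebra.Field_as_Ring"
    "HOL-Number_Theory.Totient"
begin

text \<open>Suppose \<open>\<rho> = 1\<close> and write \<open>deg \<Phi>\<^sub>k = 2d\<close>; then \<open>t\<close> and \<open>y\<close> have degree at most \<open>d\<close>, and comparing
  degrees in \<open>\<Phi>\<^sub>k | q + 1 - t\<close> gives \<open>(t - 2)\<^sup>2 + D y\<^sup>2 = C \<Phi>\<^sub>k\<close> for a constant \<open>C\<close>. Evaluate at a complex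
  primitive \<open>k\<close>-th root of unity \<open>z\<close>.

  If \<open>d = 1\<close>, then \<open>t\<close> and \<open>y\<close> are linear, and \<open>t(z) / y(z)\<close> is real because \<open>\<surd>(-D)\<close> and
  \<open>(\<eta> + 1) / (\<eta> - 1)\<close> are both purely imaginary. Hence \<open>t\<close> and \<open>y\<close> are proportional and \<open>q\<close> is a
  multiple of a square.

  If \<open>d > 1\<close>, a power of \<open>x\<close> with exponent coprime to \<open>k\<close> reduces modulo \<open>\<Phi>\<^sub>k\<close> to a polynomial
  of degree at most \<open>d\<close> only if that is a signed
  monomial, so \<open>t - 2 = \<epsilon> x\<^sup>b - 1\<close> with \<open>b \<le> d\<close>. Complex conjugation at \<open>z\<close> shows that the reversal
  \<open>x\<^sup>d y(1/x)\<close> equals \<open>\<epsilon> x\<^bsup>d-b\<^esup> y\<close>, which forces \<open>b = d\<close>. As the exponent of \<open>\<eta>\<close> is coprime to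
  \<open>k\<close>, this leaves \<open>k = p\<close> and \<open>k = 2p\<close>, which are excluded by evaluating the norm equation at
  \<open>0\<close>, \<open>1\<close> and \<open>-1\<close>.\<close>

section \<open>Evaluating rational polynomials at complex numbers\<close>

definition cpoly :: "rat poly \<Rightarrow> complex \<Rightarrow> complex" where
  "cpoly f z = poly (map_poly of_rat f) z"

lemma map_poly_of_rat_monom:
  "map_poly (of_rat :: rat \<Rightarrow> complex) (monom c n) = monom (of_rat c) n"
  by (rule poly_eqI) simp

lemma cpoly_add [simp]: "cpoly (f + g) z = cpoly f z + cpoly g z"
  by (simp add: cpoly_def map_poly_of_rat_add)

lemma cpoly_mult [simp]: "cpoly (f * g) z = cpoly f z * cpoly g z"
  by (simp add: cpoly_def map_poly_of_rat_mult)

lemma cpoly_monom [simp]: "cpoly (monom c n) z = of_rat c * z ^ n"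
  by (simp add: cpoly_def map_poly_of_rat_monom poly_monom)

lemma cpoly_0 [simp]: "cpoly 0 z = 0"
  by (simp add: cpoly_def)

lemma cpoly_1 [simp]: "cpoly 1 z = 1"
  using cpoly_monom[of 1 0 z] by simp

lemma cpoly_const [simp]: "cpoly [:c:] z = of_rat c"
  using cpoly_monom[of c 0 z] by (simp add: monom_0)

lemma cpoly_of_nat [simp]: "cpoly (of_nat n) z = of_nat n"
  by (simp add: of_nat_poly)

lemma cpoly_uminus [simp]: "cpoly (- f) z = - cpoly f z"
  using cpoly_add[of f "- f" z] by (simp add: eq_neg_iff_add_eq_0 add.commute)

lemma cpoly_diff [simp]: "cpoly (f - g) z = cpoly f z - cpoly g z"
  using cpoly_add[of f "- g" z] by simp

lemma cpoly_smult [simp]: "cpoly (smult c f) z = of_rat c * cpoly f z"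
  using cpoly_mult[of "[:c:]" f z] by simp

lemma cpoly_power [simp]: "cpoly (f ^ n) z = cpoly f z ^ n"
  by (induction n) simp_all

lemma cpoly_sum [simp]: "cpoly (\<Sum>i\<in>A. f i) z = (\<Sum>i\<in>A. cpoly (f i) z)"
  by (induction A rule: infinite_finite_induct) simp_all

lemma cpoly_altdef: "degree f \<le> n \<Longrightarrow> cpoly f z = (\<Sum>i\<le>n. of_rat (coeff f i) * z ^ i)"
  unfolding cpoly_def poly_altdef degree_map_poly_of_rat
  by (rule sum.mono_neutral_cong_left) (auto simp: coeff_eq_0)

lemma of_rat_in_Reals: "(of_rat c :: complex) \<in> \<real>"
  by (cases c) (simp add: of_rat_rat)

lemma cpoly_cnj: "cpoly f (cnj z) = cnj (cpoly f z)"
  unfolding cpoly_def by (rule poly_cnj_real[symmetric]) (simp add: of_rat_in_Reals)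

lemma cpoly_of_rat: "cpoly f (of_rat x) = of_rat (poly f x)"
  by (simp add: cpoly_def poly_altdef of_rat_sum of_rat_mult of_rat_power)

text \<open>If \<open>r\<close> did not divide \<open>f\<close>, irreducibility would make the two
  coprime, and a Bezout identity evaluated at \<open>z\<close> would read 0 = 1.\<close>

lemma dvd_of_common_root:
  assumes "irreducible r" "cpoly r z = 0" "cpoly f z = 0"
  shows "r dvd f"
proof (rule ccontr)
  assume "\<not> r dvd f"
  with assms(1) have "coprime r f"
    by (intro coprimeI) (blast dest: irreducibleD' dvd_trans)
  then have "fst (bezout_coefficients r f) * r + snd (bezout_coefficients r f) * f = 1"
    by (simp add: bezout_coefficients_fst_snd)
  then have "cpoly (fst (bezout_coefficients r f) * r + snd (bezout_coefficients r f) * f) z = 1"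
    by simp
  then show False using assms by simp
qed

lemma cpoly_eq_0_iff_dvd:
  assumes "irreducible r" "cpoly r z = 0"
  shows "cpoly f z = 0 \<longleftrightarrow> r dvd f"
  using dvd_of_common_root[OF assms] assms(2) by (auto elim!: dvdE)

text \<open>A nonzero difference of degree below \<open>degree r\<close> is not divisible by
  \<open>r\<close>. This turns identities of complex values at one root back into identities of
  rational polynomials.\<close>

lemma cpoly_inj_degree:
  assumes "irreducible r" "cpoly r z = 0" "cpoly f z = cpoly g z"
    and "degree f < degree r" "degree g < degree r"
  shows "f = g"
proof (rule ccontr)
  assume "f \<noteq> g"
  moreover have "r dvd f - g" using assms by (intro dvd_of_common_root) auto
  ultimately have "degree r \<le> degree (f - g)" by (intro dvd_imp_degree_le) auto
  then show False using degree_diff_less[OF assms(4,5)] by simp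
qed

lemma no_rat_root:
  assumes "irreducible (r :: rat poly)" "degree r > 1"
  shows "poly r x \<noteq> 0"
proof
  assume "poly r x = 0"
  then have "[:-x, 1:] dvd r" by (simp add: poly_eq_0_iff_dvd)
  moreover have "\<not> r dvd [:-x, 1:]" using assms(2) dvd_imp_degree_le[of r "[:-x, 1:]"] by auto
  ultimately have "[:-x, 1:] dvd 1" using irreducibleD'[OF assms(1)] by blast
  then show False using dvd_imp_degree_le[of "[:-x, 1:]" 1] by simp
qed

lemma dvd_degree_le_imp_smult:
  fixes r f :: "rat poly"
  assumes "r dvd f" "degree f \<le> degree r"
  shows "\<exists>c. f = smult c r"
proof (cases "f = 0")
  case False
  from assms(1) obtain g where g: "f = r * g" by (elim dvdE)
  with False have "degree f = degree r + degree g" by (auto simp: degree_mult_eq)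
  with assms(2) have "degree g = 0" by simp
  then obtain c where "g = [:c:]" by (rule degree_eq_zeroE)
  with g show ?thesis by auto
qed (auto intro: exI[of _ 0])

section \<open>Roots of unity\<close>

lemma cyclotomic_root_iff:
  "k > 0 \<Longrightarrow> cpoly (cyclotomic_poly k) z = 0 \<longleftrightarrow> z \<in> complex_primitive_roots k"
  by (simp add: cpoly_def map_poly_of_rat_cyclotomic_poly poly_prod finite_complex_primitive_roots)

lemma degree_cyclotomic_poly:
  assumes "k > 0"
  shows "degree (cyclotomic_poly k) = card (complex_primitive_roots k)"
proof -
  have "degree (cyclotomic_poly k) = degree (\<Prod>z\<in>complex_primitive_roots k. [:- z, 1:])"
    by (metis degree_map_poly_of_rat map_poly_of_rat_cyclotomic_poly[OF assms])
  also have "\<dots> = card (complex_primitive_roots k)"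
    by (subst degree_prod_eq_sum_degree) auto
  finally show ?thesis .
qed

lemma primitive_root_power_eq_1_iff:
  assumes "z \<in> complex_primitive_roots k" "k > 0"
  shows "z ^ j = 1 \<longleftrightarrow> k dvd j"
proof
  assume "z ^ j = 1"
  have zk: "z ^ k = 1" using assms by (simp add: complex_primitive_roots_def)
  have "z ^ j = (z ^ k) ^ (j div k) * z ^ (j mod k)"
    by (metis mult_div_mod_eq power_add power_mult)
  with zk \<open>z ^ j = 1\<close> have "z ^ (j mod k) = 1" by simp
  moreover have "z ^ (j mod k) \<noteq> 1" if "j mod k > 0"
    using assms that by (simp add: complex_primitive_roots_def)
  ultimately show "k dvd j" by (auto simp: dvd_eq_mod_eq_0)
next
  assume "k dvd j"
  then show "z ^ j = 1" using assms by (auto simp: complex_primitive_roots_def power_mult elim!: dvdE)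
qed

lemma primitive_root_inj_on:
  assumes "z \<in> complex_primitive_roots k" "k > 0"
  shows "inj_on (\<lambda>j. z ^ j) {..<k}"
proof -
  have *: False if "i < j" "j < k" "z ^ i = z ^ j" for i j
  proof -
    have "z \<noteq> 0" using assms by (auto simp: complex_primitive_roots_def zero_power)
    moreover have "z ^ j = z ^ i * z ^ (j - i)"
      using that(1) by (metis le_add_diff_inverse less_imp_le power_add)
    ultimately have "z ^ (j - i) = 1" using that by simp
    then have "k dvd j - i" using primitive_root_power_eq_1_iff[OF assms] by simp
    then show False using that by (auto dest: dvd_imp_le)
  qed
  show ?thesis
    by (rule inj_onI) (metis "*" lessThan_iff linorder_neqE_nat)
qed

text \<open>The powers of \<open>z\<close> with exponent below \<open>k\<close> are distinct, and
  there are exactly \<open>k\<close> complex \<open>k\<close>-th roots of unity.\<close>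

lemma root_of_unity_eq_power:
  assumes "z \<in> complex_primitive_roots k" "k > 0" "w ^ k = 1"
  shows "\<exists>a<k. w = z ^ a"
proof -
  have "(\<lambda>j. z ^ j) ` {..<k} \<subseteq> {w. w ^ k = 1}"
    using assms(1) by (auto simp: complex_primitive_roots_def simp flip: power_mult)
       (metis mult.commute power_mult power_one)
  moreover have "card ((\<lambda>j. z ^ j) ` {..<k}) = k"
    by (simp add: card_image primitive_root_inj_on[OF assms(1,2)])
  moreover have "card {w :: complex. w ^ k = 1} = k"
    using card_roots_unity_eq assms(2) by blast
  ultimately have "(\<lambda>j. z ^ j) ` {..<k} = {w. w ^ k = 1}"
    by (intro card_subset_eq) (use assms(2) finite_roots_unity[of k] in auto)
  with assms(3) show ?thesis by blast
qed

lemma power_primitive_iff: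
  assumes "z \<in> complex_primitive_roots k" "k > 0"
  shows "z ^ a \<in> complex_primitive_roots k \<longleftrightarrow> coprime a k"
proof
  assume "z ^ a \<in> complex_primitive_roots k"
  \<comment> \<open>\<open>k\<close> divides \<open>a * (k div gcd a k)\<close>, so a common factor
    of \<open>a\<close> and \<open>k\<close> would lower the order of \<open>z ^ a\<close>.\<close>
  moreover have "(z ^ a) ^ (k div gcd a k) = 1"
    unfolding power_mult[symmetric] primitive_root_power_eq_1_iff[OF assms]
    by (metis dvd_div_mult dvd_mult gcd_dvd1 gcd_dvd2 dvd_triv_right dvd_mult_div_cancel mult.commute)
  ultimately have "k dvd k div gcd a k"
    using primitive_root_power_eq_1_iff assms(2) by blast
  moreover have "k div gcd a k > 0"
    using assms(2) by (simp add: div_greater_zero_iff gcd_le2_nat)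
  ultimately have "k \<le> k div gcd a k" by (intro dvd_imp_le)
  moreover have "gcd a k > 0" using assms(2) by simp
  ultimately have "gcd a k = 1"
    using assms(2) int_div_less_self div_less_dividend[of "gcd a k" k] by linarith
  then show "coprime a k" by (simp add: coprime_iff_gcd_eq_1)
next
  assume "coprime a k"
  then show "z ^ a \<in> complex_primitive_roots k"
    unfolding complex_primitive_roots_def mem_Collect_eq power_mult[symmetric]
      primitive_root_power_eq_1_iff[OF assms]
    by (auto simp: coprime_commute coprime_dvd_mult_right_iff dest: dvd_imp_le)
qed

lemma degree_cyclotomic_poly_totient:
  assumes "z \<in> complex_primitive_roots k" "k > 1"
  shows "degree (cyclotomic_poly k) = totient k"
proof -
  have "complex_primitive_roots k = (\<lambda>j. z ^ j) ` totatives k"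
  proof (intro equalityI subsetI)
    fix w assume w: "w \<in> complex_primitive_roots k"
    then obtain a where a: "a < k" "w = z ^ a"
      using root_of_unity_eq_power[OF assms(1)] assms(2) by (auto simp: complex_primitive_roots_def)
    with w have "coprime a k" using power_primitive_iff assms by auto
    with a assms(2) have "a \<in> totatives k"
      by (cases a) (auto simp: in_totatives_iff)
    with a show "w \<in> (\<lambda>j. z ^ j) ` totatives k" by blast
  qed (use assms in \<open>auto simp: in_totatives_iff power_primitive_iff\<close>)
  \<comment> \<open>For \<open>k > 1\<close> all totatives lie below \<open>k\<close>, where the
    powers of \<open>z\<close> are distinct; for \<open>k = 1\<close> the totative 1 does
    not.\<close>
  moreover have "inj_on (\<lambda>j. z ^ j) (totatives k)"
    by (rule inj_on_subset[OF primitive_root_inj_on[OF assms(1)]])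
       (use assms(2) totatives_less in auto)
  ultimately show ?thesis
    using assms(2) by (simp add: degree_cyclotomic_poly card_image totient_def)
qed

section \<open>The Brezing--Weng data evaluated at a complex root of unity\<close>

lemma cring_rat_poly_ring: "cring rat_poly_ring"
proof (rule cringI)
  show "abelian_group rat_poly_ring"
  proof (rule abelian_groupI)
    fix x assume "x \<in> carrier rat_poly_ring"
    show "\<exists>y\<in>carrier rat_poly_ring. y \<oplus>\<^bsub>rat_poly_ring\<^esub> x = \<zero>\<^bsub>rat_poly_ring\<^esub>"
      by (rule bexI[of _ "- x"]) (simp_all add: rat_poly_ring_def)
  qed (simp_all add: rat_poly_ring_def ac_simps)
  show "Group.comm_monoid rat_poly_ring"
    by (rule comm_monoidI) (simp_all add: rat_poly_ring_def ac_simps)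
qed (simp_all add: rat_poly_ring_def distrib_right)

lemma cyclotomic_ideal_altdef: "cyclotomic_ideal k = {f. cyclotomic_poly k dvd f}"
  by (auto simp: cyclotomic_ideal_def cgenideal_def rat_poly_ring_def dvd_def mult.commute)

lemma residue_class_altdef: "residue_class k f = {g. cyclotomic_poly k dvd g - f}"
proof -
  have "\<exists>h. cyclotomic_poly k dvd h \<and> g = h + f" if "cyclotomic_poly k dvd g - f" for g
    using that by (intro exI[of _ "g - f"]) simp
  then show ?thesis
    by (auto simp: residue_class_def a_r_coset_def' cyclotomic_ideal_altdef rat_poly_ring_def)
qed

lemma residue_class_eq_iff:
  "residue_class k f = residue_class k g \<longleftrightarrow> cyclotomic_poly k dvd f - g"
proof
  assume "residue_class k f = residue_class k g"
  moreover have "f \<in> residue_class k f" by (simp add: residue_class_altdef)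
  ultimately show "cyclotomic_poly k dvd f - g" by (simp add: residue_class_altdef)
next
  assume *: "cyclotomic_poly k dvd f - g"
  have "cyclotomic_poly k dvd h - f \<longleftrightarrow> cyclotomic_poly k dvd h - g" for h
    using dvd_add_left_iff[OF *, of "h - f"] by simp
  then show "residue_class k f = residue_class k g" by (simp add: residue_class_altdef)
qed

lemma ideal_cyclotomic: "ideal (cyclotomic_ideal k) rat_poly_ring"
  unfolding cyclotomic_ideal_def by (rule cring.cgenideal_ideal[OF cring_rat_poly_ring]) (simp add: rat_poly_ring_def)

lemma cring_cyclotomic_field: "cring (cyclotomic_field k)"
  unfolding cyclotomic_field_def
  by (rule ideal.quotient_is_cring[OF ideal_cyclotomic cring_rat_poly_ring])

lemma residue_class_hom: "residue_class k \<in> ring_hom rat_poly_ring (cyclotomic_field k)"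
  unfolding residue_class_def[abs_def] cyclotomic_field_def
  by (rule ideal.rcos_ring_hom[OF ideal_cyclotomic])

lemma residue_class_mult:
  "residue_class k (f * g) = residue_class k f \<otimes>\<^bsub>cyclotomic_field k\<^esub> residue_class k g"
  using ring_hom_mult[OF residue_class_hom, of f g] by (simp add: rat_poly_ring_def)

lemma residue_class_add:
  "residue_class k (f + g) = residue_class k f \<oplus>\<^bsub>cyclotomic_field k\<^esub> residue_class k g"
  using ring_hom_add[OF residue_class_hom, of f g] by (simp add: rat_poly_ring_def)

lemma residue_class_1: "residue_class k 1 = \<one>\<^bsub>cyclotomic_field k\<^esub>"
  using ring_hom_one[OF residue_class_hom, of k] by (simp add: rat_poly_ring_def)

lemma residue_class_carrier: "residue_class k f \<in> carrier (cyclotomic_field k)"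
  using ring_hom_closed[OF residue_class_hom, of f k] by (simp add: rat_poly_ring_def)

lemma residue_class_power:
  "residue_class k (f ^ n) = residue_class k f [^]\<^bsub>cyclotomic_field k\<^esub> n"
proof -
  interpret cring "cyclotomic_field k" by (rule cring_cyclotomic_field)
  show ?thesis
    by (induction n) (simp_all add: residue_class_1 residue_class_mult power_Suc2 del: power_Suc)
qed

lemma residue_class_surj:
  assumes "x \<in> carrier (cyclotomic_field k)"
  obtains f where "x = residue_class k f"
  using assms
  by (auto simp: cyclotomic_field_def FactRing_def A_RCOSETS_def' residue_class_def rat_poly_ring_def)

lemma residue_class_diff:
  "residue_class k (f - g) = residue_class k f \<ominus>\<^bsub>cyclotomic_field k\<^esub> residue_class k g"
proof -
  interpret cring "cyclotomic_field k" by (rule cring_cyclotomic_field)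
  note c = residue_class_carrier[of k]
  have "residue_class k (f - g) \<oplus>\<^bsub>cyclotomic_field k\<^esub> residue_class k g = residue_class k f"
    by (simp flip: residue_class_add)
  then show ?thesis using c[of f] c[of g] c[of "f - g"]
    by (metis a_minus_def add.m_assoc add.inv_closed r_neg r_zero)
qed


text \<open>Evaluation at \<open>z\<close> embeds the field into the complex numbers: two classes
  agree exactly when their representatives agree at \<open>z\<close>. So \<eta> becomes a power of
  \<open>z\<close>, and \<open>s\<close> becomes a complex square root \<sigma> of -D.\<close>

lemma brezing_weng_complex:
  assumes bw: "brezing_weng k D \<eta> s t y q" and "k > 0" "D > 0"
    and irr: "irreducible (cyclotomic_poly k)" and z: "z \<in> complex_primitive_roots k"
  obtains a \<sigma> where "coprime a k" "a < k" "\<sigma>\<^sup>2 = - of_nat D"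
    "cpoly t z = z ^ a + 1" "\<sigma> * cpoly y z = z ^ a - 1"
proof -
  let ?K = "cyclotomic_field k"
  interpret K: cring ?K by (rule cring_cyclotomic_field)
  have root: "cpoly (cyclotomic_poly k) z = 0"
    using z \<open>k > 0\<close> by (simp add: cyclotomic_root_iff)
  have eq_iff: "residue_class k f = residue_class k g \<longleftrightarrow> cpoly f z = cpoly g z" for f g
    using cpoly_eq_0_iff_dvd[OF irr root, of "f - g"] by (simp add: residue_class_eq_iff)
  note bw = bw[unfolded brezing_weng_def Let_def primitive_root_of_unity_def]
  obtain S where S: "s = residue_class k S" using bw residue_class_surj by blast
  obtain E where E: "\<eta> = residue_class k E" using bw residue_class_surj by blast
  have SS: "residue_class k (S * S) = residue_class k (- of_nat D)"
    using bw by (simp add: S residue_class_mult)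
  then have \<sigma>2: "cpoly S z * cpoly S z = - of_nat D" by (simp add: eq_iff)
  \<comment> \<open>Since \<open>s\<close> squares to -D, its inverse is -s/D.\<close>
  have "s \<otimes>\<^bsub>?K\<^esub> residue_class k (smult (- 1 / of_nat D) S) = \<one>\<^bsub>?K\<^esub>"
    unfolding S residue_class_mult[symmetric] residue_class_1[symmetric] eq_iff
    using \<sigma>2 \<open>D > 0\<close> by (simp add: of_rat_divide of_rat_minus field_simps)
  then have inv: "inv\<^bsub>?K\<^esub> s = residue_class k (smult (- 1 / of_nat D) S)"
    by (intro K.comm_inv_char) (simp_all add: S residue_class_carrier)
  have "cpoly E z ^ k = 1"
    using bw eq_iff[of "E ^ k" 1] by (simp add: E residue_class_power residue_class_1)
  moreover have "cpoly E z ^ j \<noteq> 1" if "0 < j" "j < k" for j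
    using bw that eq_iff[of "E ^ j" 1] by (simp add: E residue_class_power residue_class_1)
  ultimately have prim: "cpoly E z \<in> complex_primitive_roots k"
    by (simp add: complex_primitive_roots_def)
  then obtain a where a: "a < k" "cpoly E z = z ^ a"
    using root_of_unity_eq_power[OF z \<open>k > 0\<close>] by (auto simp: complex_primitive_roots_def)
  show ?thesis
  proof
    show "coprime a k" using prim a power_primitive_iff[OF z \<open>k > 0\<close>] by simp
    show "(cpoly S z)\<^sup>2 = - of_nat D" using \<sigma>2 by (simp add: power2_eq_square)
    have "residue_class k t = residue_class k (E + 1)"
      using bw by (simp add: E residue_class_add residue_class_1)
    then show "cpoly t z = z ^ a + 1" by (simp add: eq_iff a)
    have "residue_class k y = residue_class k ((E - 1) * smult (- 1 / of_nat D) S)"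
      unfolding residue_class_mult residue_class_diff using bw inv by (simp add: E residue_class_1)
    then have "cpoly y z = (z ^ a - 1) * (- 1 / of_nat D) * cpoly S z"
      by (simp add: eq_iff a of_rat_divide of_rat_minus)
    then have "cpoly S z * cpoly y z
        = (z ^ a - 1) * (- 1 / of_nat D) * (cpoly S z * cpoly S z)"
      by (simp only: mult.assoc mult.left_commute)
    then show "cpoly S z * cpoly y z = z ^ a - 1"
      using \<open>D > 0\<close> by (simp add: \<sigma>2)
  qed (fact a)
qed

section \<open>Sums of two squares and reversed polynomials\<close>

text \<open>For equal degrees the leading coefficients u and v contribute
  \<open>u\<^sup>2 + D * v\<^sup>2\<close>, which is positive, so the top terms cannot
  cancel.\<close>

lemma degree_sum_of_squares:
  fixes f g :: "rat poly"
  assumes "D > 0"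
  shows "degree (f\<^sup>2 + of_nat D * g\<^sup>2) = 2 * max (degree f) (degree g)"
proof -
  have deg: "degree (f\<^sup>2) = 2 * degree f" "degree (of_nat D * g\<^sup>2) = 2 * degree g"
    using assms by (cases "f = 0"; cases "g = 0"; simp add: degree_power_eq of_nat_poly)+
  show ?thesis
  proof (cases "degree f" "degree g" rule: linorder_cases)
    case equal
    let ?e = "degree f"
    show ?thesis
    proof (cases "f = 0")
      case False
      have "coeff (f\<^sup>2 + of_nat D * g\<^sup>2) (2 * ?e) = (lead_coeff f)\<^sup>2 + of_nat D * (lead_coeff g)\<^sup>2"
        using coeff_mult_degree_sum[of f f] coeff_mult_degree_sum[of g g] equal
        by (simp add: power2_eq_square mult_2 of_nat_poly)
      moreover have "\<dots> > 0" using False by (intro add_pos_nonneg) auto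
      ultimately have "degree (f\<^sup>2 + of_nat D * g\<^sup>2) \<ge> 2 * ?e" by (intro le_degree) auto
      moreover have "degree (f\<^sup>2 + of_nat D * g\<^sup>2) \<le> 2 * ?e"
        using deg equal by (intro degree_add_le) auto
      ultimately show ?thesis using equal by simp
    qed (use deg equal in auto)
  qed (use deg in \<open>auto simp: degree_add_eq_left degree_add_eq_right\<close>)
qed

text \<open>For \<open>degree f \<le> d\<close> this is \<open>x ^ d * f (1 / x)\<close>. The
  parameter \<open>d\<close> is separate because the degree of \<open>y\<close> may be
  smaller.\<close>

definition rev_poly :: "nat \<Rightarrow> rat poly \<Rightarrow> rat poly" where
  "rev_poly d f = (\<Sum>i\<le>d. monom (coeff f (d - i)) i)"

lemma degree_rev_poly: "degree (rev_poly d f) \<le> d"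
  unfolding rev_poly_def by (intro degree_sum_le) (auto intro: order.trans[OF degree_monom_le])

lemma cpoly_rev_poly:
  assumes "degree f \<le> d" "z \<noteq> 0"
  shows "cpoly (rev_poly d f) z = z ^ d * cpoly f (1 / z)"
proof -
  have "cpoly (rev_poly d f) z = (\<Sum>i\<le>d. of_rat (coeff f (d - i)) * z ^ i)"
    by (simp add: rev_poly_def)
  also have "\<dots> = (\<Sum>i\<le>d. of_rat (coeff f i) * z ^ (d - i))"
    by (rule sum.reindex_bij_witness[of _ "\<lambda>i. d - i" "\<lambda>i. d - i"]) auto
  also have "\<dots> = (\<Sum>i\<le>d. z ^ d * (of_rat (coeff f i) * (1 / z) ^ i))"
    using assms(2) by (intro sum.cong) (auto simp: power_diff power_one_over field_simps)
  also have "\<dots> = z ^ d * cpoly f (1 / z)"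
    by (simp add: cpoly_altdef[OF assms(1)] sum_distrib_left)
  finally show ?thesis .
qed

lemma poly_rev_poly:
  assumes "degree f \<le> d" "x \<noteq> 0"
  shows "poly (rev_poly d f) x = x ^ d * poly f (1 / x)"
proof -
  have "(of_rat (poly (rev_poly d f) x) :: complex) = of_rat (x ^ d * poly f (1 / x))"
    using cpoly_rev_poly[OF assms(1), of "of_rat x"] assms(2)
    by (simp add: of_rat_mult of_rat_power of_rat_divide flip: cpoly_of_rat)
  then show ?thesis by simp
qed

lemma degree_monom_diff_1:
  fixes \<epsilon> :: rat
  assumes "\<epsilon> \<noteq> 0" "b > 0"
  shows "degree (monom \<epsilon> b - 1) = b"
  using assms degree_add_eq_left[of "- 1" "monom \<epsilon> b"] by (simp add: degree_monom_eq)

text \<open>The square is a negative real, so \<sigma> is purely imaginary.\<close>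

lemma cnj_of_square_negative:
  assumes "\<sigma>\<^sup>2 = - of_nat D" "D > 0"
  shows "cnj \<sigma> = - \<sigma>"
proof -
  have "\<sigma>\<^sup>2 = complex_of_real (- real D)" using assms(1) by simp
  then have "Re (\<sigma>\<^sup>2) = - real D" "Im (\<sigma>\<^sup>2) = 0" by (simp_all only: Re_complex_of_real Im_complex_of_real)
  then have "Re \<sigma> = 0"
    using assms(2) by (auto simp: power2_eq_square)
      (metis not_real_square_gt_zero of_nat_0_less_iff neg_less_0_iff_less not_less_iff_gr_or_eq)
  then show ?thesis by (simp add: complex_eq_iff)
qed

text \<open>On the unit circle \<open>cnj z = 1 / z\<close>, so the reversal of \<open>y\<close>
  takes at \<open>z\<close> the value \<open>z ^ d\<close> times the conjugate of y(z). Conjugating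
  the equation for \<open>y\<close> thus makes the reversal a monomial multiple of
  \<open>y\<close>.\<close>

lemma rev_poly_of_norm_equation:
  fixes r y :: "rat poly" and \<epsilon> :: rat
  assumes irr: "irreducible r" and root: "cpoly r z = 0" and z: "z * cnj z = 1"
    and deg: "degree r = 2 * d" "degree y \<le> d" and b: "0 < b" "b \<le> d"
    and \<epsilon>: "\<epsilon>\<^sup>2 = 1" and \<sigma>: "\<sigma>\<^sup>2 = - of_nat D" and D: "D > 0"
    and y: "\<sigma> * cpoly y z = of_rat \<epsilon> * z ^ b - 1"
    and norm: "(monom \<epsilon> b - 1)\<^sup>2 + of_nat D * y\<^sup>2 = smult C r" and C: "C \<noteq> 0"
  shows "b = d" "rev_poly d y = smult \<epsilon> y"
proof -
  have \<epsilon>0: "\<epsilon> \<noteq> 0" using \<epsilon> by auto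
  have z0: "z \<noteq> 0" using z by auto
  then have z_inv: "1 / z = cnj z" using z by (metis nonzero_mult_div_cancel_left)
  have \<sigma>0: "\<sigma> \<noteq> 0" using \<sigma> D by auto
  have cnj_\<sigma>: "cnj \<sigma> = - \<sigma>" by (rule cnj_of_square_negative[OF \<sigma> D])
  have cnj_\<epsilon>: "cnj (of_rat \<epsilon>) = of_rat \<epsilon>" using of_rat_in_Reals Reals_cnj_iff by blast
  have zb: "z ^ b * cnj z ^ b = 1" using z by (simp flip: power_mult_distrib)
  define e :: complex where "e = of_rat \<epsilon>"
  have ee: "e * e = 1" using \<epsilon> by (simp add: e_def power2_eq_square flip: of_rat_mult)
  have "cnj (\<sigma> * cpoly y z) = e * cnj z ^ b - 1" by (simp add: y cnj_\<epsilon> e_def)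
  then have conj: "\<sigma> * cpoly y (cnj z) = 1 - e * cnj z ^ b"
    by (simp add: cnj_\<sigma> cpoly_cnj algebra_simps)
  have "\<sigma> * cpoly (rev_poly d y) z = z ^ d * (\<sigma> * cpoly y (cnj z))"
    using cpoly_rev_poly[OF deg(2) z0] z_inv by simp
  also have "\<dots> = z ^ (d - b) * z ^ b * (1 - e * cnj z ^ b)"
    using b by (simp add: conj flip: power_add)
  also have "\<dots> = z ^ (d - b) * (z ^ b - e)"
    using zb by (simp add: algebra_simps)
  \<comment> \<open>\<open>e * e = 1\<close> recovers the right-hand side of the equation for
    \<open>y\<close>.\<close>
  also have "\<dots> = z ^ (d - b) * (e * (e * z ^ b - 1))"
    using ee by (simp add: algebra_simps flip: mult.assoc)
  also have "\<dots> = \<sigma> * (e * z ^ (d - b) * cpoly y z)" using y by (simp add: e_def)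
  finally have "cpoly (rev_poly d y) z = cpoly (monom \<epsilon> (d - b) * y) z"
    using \<sigma>0 by (simp add: e_def)
  \<comment> \<open>This is at most \<open>2 * d - b\<close>, and \<open>b > 0\<close> keeps it
    below \<open>degree r\<close>.\<close>
  moreover have "degree (monom \<epsilon> (d - b) * y) \<le> (d - b) + degree y"
    using degree_mult_le[of "monom \<epsilon> (d - b)" y] degree_monom_le[of \<epsilon> "d - b"] by linarith
  ultimately have rev: "rev_poly d y = monom \<epsilon> (d - b) * y"
    using degree_rev_poly[of d y] deg b by (intro cpoly_inj_degree[OF irr root]) auto
  show "b = d"
  proof (rule ccontr)
    assume "b \<noteq> d"
    \<comment> \<open>If \<open>b < d\<close>, only \<open>y\<close> can supply the degree
      \<open>2 * d\<close>; then \<open>monom \<epsilon> (d - b) * y\<close> has degree above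
      \<open>d\<close>, too large for a reversal.\<close>
    have "degree ((monom \<epsilon> b - 1)\<^sup>2 + of_nat D * y\<^sup>2) = 2 * d"
      using norm C deg by simp
    then have "max b (degree y) = d"
      using degree_sum_of_squares[OF D, of "monom \<epsilon> b - 1" y]
      by (simp add: degree_monom_diff_1[OF \<epsilon>0 b(1)])
    with \<open>b \<noteq> d\<close> have "degree y = d" by (simp add: max_def split: if_splits)
    moreover from this b have "y \<noteq> 0" by auto
    ultimately have "degree (rev_poly d y) = (d - b) + d"
      using \<epsilon>0 by (simp add: rev degree_mult_eq degree_monom_eq)
    with degree_rev_poly[of d y] b \<open>b \<noteq> d\<close> show False by simp
  qed
  with rev show "rev_poly d y = smult \<epsilon> y" by (simp add: monom_0)
qed

text \<open>After clearing denominators, a nonzero solution would have \<open>p\<close> to an odd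
  exponent on the left and to an even exponent on the right.\<close>

lemma prime_mult_square_eq_square:
  fixes u v :: rat
  assumes p: "prime (p :: nat)" and c: "\<not> p dvd c" and eq: "of_nat (p * c) * u\<^sup>2 = v\<^sup>2"
  shows "u = 0"
proof (rule ccontr)
  assume "u \<noteq> 0"
  obtain a b where u: "u = of_int a / of_int b" "b > 0" by (cases u) (auto simp: Fract_of_int_quotient)
  obtain a' b' where v: "v = of_int a' / of_int b'" "b' > 0" by (cases v) (auto simp: Fract_of_int_quotient)
  have "a \<noteq> 0" using \<open>u \<noteq> 0\<close> u by auto
  have c0: "c \<noteq> 0" using c by (metis dvd_0_right)
  have "(of_int (int (p * c) * (a * b')\<^sup>2) :: rat) = of_int ((a' * b)\<^sup>2)"
    using eq u v by (simp add: field_simps power2_eq_square)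
  then have *: "int p * (int c * (a * b')\<^sup>2) = (a' * b)\<^sup>2"
    by (simp only: of_int_eq_iff of_nat_mult mult.assoc)
  have nz: "a * b' \<noteq> 0" using \<open>a \<noteq> 0\<close> v by simp
  have pp: "prime_elem (int p)" using p by auto
  have "a' * b \<noteq> 0" using * nz c0 p by (auto dest: prime_gt_0_nat)
  have "multiplicity (int p) ((a' * b)\<^sup>2) = 2 * multiplicity (int p) (a' * b)"
    using pp \<open>a' * b \<noteq> 0\<close> by (simp add: prime_elem_multiplicity_power_distrib)
  moreover have "multiplicity (int p) (int p * (int c * (a * b')\<^sup>2)) = Suc (2 * multiplicity (int p) (a * b'))"
  proof -
    have "multiplicity (int p) (int c) = 0"
      using c by (intro not_dvd_imp_multiplicity_0) simp
    then have "multiplicity (int p) (int c * (a * b')\<^sup>2) = 2 * multiplicity (int p) (a * b')"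
      using pp nz c0
      by (simp add: prime_elem_multiplicity_mult_distrib prime_elem_multiplicity_power_distrib)
    then show ?thesis
      using nz c0 prime_elem_not_unit[OF pp] prime_gt_0_nat[OF p]
        multiplicity_times_same[where p = "int p" and x = "int c * (a * b')\<^sup>2"] pp
      by auto
  qed
  ultimately show False using * by (metis double_not_eq_Suc_double)
qed

section \<open>The case of a prime power times a power of two\<close>

text \<open>In the second case \<open>M = N / p\<close>, so that \<open>\<Phi>\<^sub>k(x)\<close> is \<open>\<Phi>\<^sub>p(\<plusminus> x\<^sup>M)\<close>.\<close>

lemma prime_power_totient_half:
  fixes p m n k d :: nat
  assumes p: "prime p" "odd p" and k: "k = 2 ^ m * p ^ n" and d: "totient k = 2 * d" "d > 1"
  defines "N \<equiv> if even k then k div 2 else k"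
  obtains "n = 0" "2 dvd k" "2 dvd N" "2 dvd d" "N = 2 * d"
  | M where "n > 0" "N = M * p" "2 * d = M * (p - 1)" "M dvd N" "M dvd d" "M dvd k"
      "M = 1 \<Longrightarrow> k = p \<or> k = 2 * p"
proof (cases "n = 0")
  case True
  \<comment> \<open>The totients of 1, 2 and 4 are at most 2, hence below \<open>2 * d\<close>. From
    \<open>m \<ge> 3\<close> it follows that both \<open>d\<close> and \<open>N\<close> are
    even.\<close>
  have "m > 2"
  proof (rule ccontr)
    assume "\<not> m > 2"
    then have "m = 0 \<or> m = 1 \<or> m = 2" by auto
    with d k True show False by auto
  qed
  then obtain l where l: "m = Suc (Suc (Suc l))"
    by (metis One_nat_def less_imp_Suc_add numeral_2_eq_2 add_Suc plus_nat.simps)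
  have "totient k = 2 ^ Suc (Suc l)"
    using totient_prime_power_Suc[of 2 "Suc (Suc l)"] k l True by simp
  then have "d = 2 * 2 ^ l" using d(1) by simp
  moreover have "k = 8 * 2 ^ l" using k l True by simp
  moreover from this have "N = 4 * 2 ^ l" by (simp add: N_def)
  ultimately show ?thesis using that(1) True by simp
next
  case False
  then obtain n' where n: "n = Suc n'" by (cases n) auto
  \<comment> \<open>Halving \<open>p - 1\<close> gives \<open>d = M * h\<close>, whence
    \<open>M dvd d\<close>.\<close>
  obtain h where h: "p = Suc (2 * h)" using p(2) by (auto elim: oddE)
  have tp: "totient (p ^ n) = p ^ n' * (p - 1)"
    using totient_prime_power_Suc[OF p(1), of n'] n by simp
  have cop: "coprime (2 ^ m) (p ^ n)" using p(2) by simp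
  show ?thesis
  proof (cases m)
    case 0
    then have "odd k" using k p(2) by simp
    show ?thesis
    proof (rule that(2)[of "p ^ n'"])
      show "2 * d = p ^ n' * (p - 1)" using d tp k 0 by simp
      then have "d = p ^ n' * h" using h by simp
      then show "p ^ n' dvd d" by simp
    qed (use 0 False n k \<open>odd k\<close> p(1) prime_gt_1_nat[OF p(1)] in \<open>auto simp: N_def\<close>)
  next
    case (Suc l)
    then have "even k" using k by simp
    have "totient k = 2 ^ l * (p ^ n' * (p - 1))"
      using totient_mult_coprime[OF cop] totient_prime_power_Suc[of 2 l] tp k Suc by simp
    then have dh: "2 * d = 2 ^ l * p ^ n' * (p - 1)" using d by simp
    then have "d = 2 ^ l * p ^ n' * h" using h by simp
    moreover have "N = 2 ^ l * p ^ n' * p" using \<open>even k\<close> k Suc n by (simp add: N_def)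
    moreover have "k = 2 ^ l * p ^ n' * (2 * p)" using k Suc n by simp
    ultimately show ?thesis
      using that(2)[of "2 ^ l * p ^ n'"] dh False by simp
  qed
qed

section \<open>Reducing powers of a root of unity\<close>

lemma complex_root_half_power:
  assumes z: "z \<in> complex_primitive_roots k" and "k > 0" "even k"
  shows "z ^ (k div 2) = -1"
proof -
  have "(z ^ (k div 2))\<^sup>2 = 1"
    using z \<open>even k\<close> by (simp add: complex_primitive_roots_def flip: power_mult)
  moreover have "z ^ (k div 2) \<noteq> 1"
    using z \<open>k > 0\<close> \<open>even k\<close> by (auto simp: complex_primitive_roots_def elim!: evenE)
  ultimately show ?thesis by (simp add: power2_eq_1_iff)
qed

text \<open>For even \<open>k\<close>, \<open>z ^ (k div 2) = -1\<close> lowers the exponent below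
  \<open>N\<close> at the cost of a sign. In the signed case the original exponent is
  \<open>b + N\<close>, and that is the number coprime to \<open>k\<close>.\<close>

lemma half_reduction:
  assumes z: "z \<in> complex_primitive_roots k" and "k > 0" and a: "coprime a k" "a < k"
  defines "N \<equiv> if even k then k div 2 else k"
  obtains b and \<epsilon> :: rat where "b < N" "z ^ a = of_rat \<epsilon> * z ^ b"
    "\<epsilon> = 1 \<and> coprime b k \<or> \<epsilon> = -1 \<and> even k \<and> coprime (b + N) k"
proof (cases "a < N")
  case True
  then show ?thesis using that[of a 1] a by simp
next
  case False
  then have ev: "even k" and N: "N = k div 2" "k = 2 * N" using a by (auto simp: N_def split: if_splits)
  have "z ^ a = z ^ N * z ^ (a - N)" using False by (simp flip: power_add)
  then have "z ^ a = of_rat (-1) * z ^ (a - N)"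
    using complex_root_half_power[OF z \<open>k > 0\<close> ev] N(1) by (simp add: of_rat_minus)
  moreover have "a - N < N" using a(2) N(2) False by linarith
  ultimately show ?thesis using that[of "a - N" "-1"] a ev False by simp
qed

text \<open>\<open>\<delta> * z ^ M\<close> is a nontrivial \<open>p\<close>-th root of unity, so
  its geometric sum vanishes.\<close>

lemma sum_power_primitive_root:
  fixes \<delta> :: rat
  assumes z: "z \<in> complex_primitive_roots k" and p: "prime p" "odd p"
    and N: "N = (if even k then k div 2 else k)" "N = M * p" "k > 0"
    and \<delta>: "\<delta> = (if even k then -1 else 1)"
  shows "(\<Sum>i<p. of_rat \<delta> ^ i * z ^ (M * i)) = 0"
proof -
  define w where "w = of_rat \<delta> * z ^ M"
  have M: "M > 0" using N by (cases M) (auto split: if_splits elim!: evenE)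
  have p1: "p > 1" using prime_gt_1_nat p by blast
  have "w ^ p = of_rat \<delta> ^ p * z ^ N" by (simp add: w_def N(2) power_mult_distrib power_mult)
  also have "\<dots> = 1"
    using z N p complex_root_half_power[OF z]
    by (auto simp: \<delta> of_rat_minus complex_primitive_roots_def)
  finally have wp: "w ^ p = 1" .
  \<comment> \<open>Squaring removes the sign: \<open>w = 1\<close> would give
    \<open>k \<le> 2 * M\<close>, against \<open>3 * M \<le> N \<le> k\<close>.\<close>
  have "w \<noteq> 1"
  proof
    assume "w = 1"
    then have "w\<^sup>2 = 1" by simp
    then have "z ^ (2 * M) = 1"
      by (simp add: w_def \<delta> power_mult_distrib of_rat_minus mult.commute[of 2] power_mult split: if_splits)
    then have "k dvd 2 * M" using primitive_root_power_eq_1_iff[OF z N(3)] by simp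
    then have "k \<le> 2 * M" using M by (intro dvd_imp_le) auto
    moreover have "N \<le> k" by (simp add: N(1))
    moreover have "M * 3 \<le> M * p" using p p1 by (intro mult_le_mono) (auto simp: odd_iff_mod_2_eq_one; presburger)+
    ultimately show False using N(2) M by linarith
  qed
  have "(\<Sum>i<p. w ^ i) = 0" using geometric_sum[OF \<open>w \<noteq> 1\<close>, of p] wp by simp
  then show ?thesis by (simp add: w_def power_mult_distrib power_mult)
qed

text \<open>A signed monomial of degree below \<open>2 * d\<close> is already reduced modulo the
  cyclotomic polynomial and so can be read off from \<open>t\<close>. Larger exponents, still below
  \<open>N\<close>, leave a remainder that is too long.\<close>

lemma trace_shape:
  fixes t :: "rat poly"
  assumes irr: "irreducible (cyclotomic_poly k)" and z: "z \<in> complex_primitive_roots k"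
    and k0: "k > 0" and p: "prime p" "odd p" and k: "k = 2 ^ m * p ^ n"
    and d: "totient k = 2 * d" "degree (cyclotomic_poly k) = 2 * d" "d > 1"
    and a: "coprime a k" "a < k" and t: "degree t \<le> d" "cpoly t z = z ^ a + 1"
  obtains b and \<epsilon> :: rat where "0 < b" "b \<le> d" "t = monom \<epsilon> b + 1"
    "\<epsilon> = 1 \<and> coprime b k \<or>
     \<epsilon> = -1 \<and> even k \<and> coprime (b + (if even k then k div 2 else k)) k"
proof -
  define N where "N = (if even k then k div 2 else k)"
  obtain b and \<epsilon> :: rat where b: "b < N" "z ^ a = of_rat \<epsilon> * z ^ b"
    and \<epsilon>: "\<epsilon> = 1 \<and> coprime b k \<or> \<epsilon> = -1 \<and> even k \<and> coprime (b + N) k"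
    using half_reduction[OF z k0 a] unfolding N_def by metis
  have \<epsilon>0: "\<epsilon> \<noteq> 0" using \<epsilon> by auto
  have root: "cpoly (cyclotomic_poly k) z = 0" using z k0 by (simp add: cyclotomic_root_iff)
  have k2: "k > 2"
  proof (rule ccontr)
    assume "\<not> k > 2"
    then have "k = 0 \<or> k = 1 \<or> k = 2" by auto
    with d show False by auto
  qed
  \<comment> \<open>Exponent 0 would make either 0 or \<open>N = k div 2\<close> coprime to
    \<open>k\<close>, forcing \<open>k \<le> 2\<close>.\<close>
  have b0: "b > 0"
  proof (rule ccontr)
    assume "\<not> b > 0"
    with \<epsilon> k2 have "even k" "coprime N k" by auto
    then have "N dvd k" "N = k div 2" by (auto simp: N_def)
    with \<open>coprime N k\<close> have "k div 2 = 1" by (simp add: coprime_absorb_left)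
    with \<open>even k\<close> k2 show False by (auto elim!: evenE)
  qed
  show ?thesis
  proof (cases "b < 2 * d")
    case True
    have deg: "degree (monom \<epsilon> b + 1) = b"
      using \<epsilon>0 b0 degree_add_eq_left[of 1 "monom \<epsilon> b"] by (simp add: degree_monom_eq)
    have "t = monom \<epsilon> b + 1"
      using t b d True deg by (intro cpoly_inj_degree[OF irr root]) auto
    with deg t b0 \<epsilon> show ?thesis using that[of b \<epsilon>] by (simp add: N_def)
  next
    case False
    from p k d(1,3) show ?thesis
    proof (cases rule: prime_power_totient_half)
      case 1
      with b False show ?thesis by (simp add: N_def)
    next
      case (2 M)
      define c where "c = b - 2 * d"
      define \<delta> :: rat where "\<delta> = (if even k then -1 else 1)"
      obtain h where h: "p = Suc (2 * h)" using p(2) by (auto elim: oddE)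
      have h0: "h > 0" using h prime_gt_1_nat[OF p(1)] by (cases h) auto
      have N: "N = M * p" and dM: "2 * d = M * (2 * h)" using 2 h by (simp_all add: N_def)
      have M0: "M > 0" using dM d(3) by (cases M) auto
      have bc: "b = M * (2 * h) + c" using False dM by (simp add: c_def)
      have "c < M" using b(1) bc N h by simp
      have "(\<Sum>i<p. of_rat \<delta> ^ i * z ^ (M * i)) = 0"
        by (rule sum_power_primitive_root[OF z p N_def N k0 \<delta>_def])
      moreover have "of_rat \<delta> ^ (2 * h) = (1 :: complex)"
        by (simp add: \<delta>_def of_rat_minus)
      ultimately have z2d: "z ^ (M * (2 * h)) = - (\<Sum>i<2*h. of_rat \<delta> ^ i * z ^ (M * i))"
        by (simp add: h eq_neg_iff_add_eq_0 add.commute)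
      \<comment> \<open>\<open>u - 1\<close> is \<epsilon> times the remainder of
        \<open>x ^ b\<close>, obtained by replacing \<open>x ^ (2 * d)\<close> through the vanishing
        sum.\<close>
      define u where "u = 1 - smult \<epsilon> (\<Sum>i<2*h. monom (\<delta> ^ i) (M * i + c))"
      have "cpoly u z = 1 - of_rat \<epsilon> * (\<Sum>i<2*h. of_rat \<delta> ^ i * z ^ (M * i)) * z ^ c"
        by (simp add: u_def of_rat_power power_add sum_distrib_right mult.assoc)
      also have "\<dots> = z ^ a + 1"
        using b(2) bc z2d by (simp add: power_add)
      finally have u: "cpoly u z = cpoly t z" using t by simp
      \<comment> \<open>The remainder of \<open>x\<^sup>b\<close> has degree \<open>e\<close>, which is at most \<open>d\<close> only for \<open>p = 3\<close> and \<open>c = 0\<close>.\<close>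
      define e where "e = M * (2 * h - 1) + c"
      have e: "e < 2 * d" "e > 0"
        using dM \<open>c < M\<close> h0 M0 by (cases h; simp add: e_def)+
      have "degree u \<le> e" unfolding u_def
      proof (intro degree_diff_le degree_smult_le[THEN order.trans] degree_sum_le)
        fix i assume "i \<in> {..<2*h}"
        then have "i \<le> 2 * h - 1" by auto
        then have "M * i + c \<le> e" by (simp add: e_def)
        then show "degree (monom (\<delta> ^ i) (M * i + c)) \<le> e"
          using degree_monom_le order.trans by blast
      qed auto
      then have "t = u"
        using t e d u by (intro cpoly_inj_degree[OF irr root]) auto
      \<comment> \<open>Only the last summand reaches degree \<open>e\<close>, and
        \<open>e > 0\<close> keeps the constant 1 out.\<close>
      have "coeff u e = - \<epsilon> * (\<Sum>i<2*h. if i = 2 * h - 1 then \<delta> ^ i else 0)"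
        using e(2) M0 by (auto simp: u_def e_def coeff_sum coeff_1 intro!: sum.cong)
      also have "\<dots> \<noteq> 0" using h0 \<epsilon>0 by (simp add: \<delta>_def)
      finally have "e \<le> degree t" using \<open>t = u\<close> by (simp add: le_degree)
      then have "2 * e \<le> M * (2 * h)" using t dM by simp
      then have "h = 1 \<and> c = 0" using M0 h0 by (cases h) (auto simp: e_def algebra_simps)
      \<comment> \<open>\<open>M\<close> now divides \<open>k\<close> and also the exponent coprime
        to \<open>k\<close>, be it \<open>b\<close> or \<open>b + N\<close>, although
        \<open>M = d > 1\<close>.\<close>
      then have "M = d" "M dvd b" using dM bc by auto
      moreover have "M dvd b + N" using \<open>M dvd b\<close> N by simp
      ultimately have "is_unit M" using \<epsilon> 2 by (meson coprime_common_divisor)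
      with \<open>M = d\<close> d(3) show ?thesis by simp
    qed
  qed
qed

section \<open>The quadratic case\<close>

lemma degree_le_1_eq:
  "degree f \<le> 1 \<Longrightarrow> f = [:coeff f 0, coeff f 1:]"
  by (rule poly_eqI) (auto simp: coeff_pCons coeff_eq_0 split: nat.split)

text \<open>Proportional \<open>t\<close> and \<open>y\<close> of degree at most 1 share a rational
  root, which is then a root of \<open>q\<close>.\<close>

lemma quadratic_family_not_irreducible:
  fixes t y q r :: "rat poly"
  assumes irr: "irreducible r" "degree r = 2" and root: "cpoly r z = 0"
    and z: "z * cnj z = 1" and w: "w * cnj w = 1"
    and \<sigma>: "\<sigma>\<^sup>2 = - of_nat D" and D: "D > 0"
    and t: "degree t \<le> 1" "cpoly t z = w + 1" and y: "degree y \<le> 1" "\<sigma> * cpoly y z = w - 1"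
    and q: "q = smult (1 / 4) (t\<^sup>2 + of_nat D * y\<^sup>2)" "degree q = 2"
  shows "\<not> irreducible q"
proof
  assume irr_q: "irreducible q"
  \<comment> \<open>A real \<open>z\<close> of modulus 1 would be a rational root of the irreducible
    quadratic \<open>r\<close>.\<close>
  have z_nonreal: "z \<noteq> cnj z"
  proof
    assume "z = cnj z"
    with z have "z\<^sup>2 = 1" by (simp add: power2_eq_square)
    then have "z = of_rat 1 \<or> z = of_rat (-1)" by (simp add: power2_eq_1_iff of_rat_minus)
    with root have "\<exists>x. poly r x = 0" by (metis cpoly_of_rat of_rat_eq_0_iff)
    with no_rat_root[OF irr(1)] irr(2) show False by simp
  qed
  obtain \<alpha> \<beta> where \<alpha>\<beta>: "t = [:\<alpha>, \<beta>:]" using degree_le_1_eq[OF t(1)] by blast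
  obtain \<gamma> \<delta> where \<gamma>\<delta>: "y = [:\<gamma>, \<delta>:]" using degree_le_1_eq[OF y(1)] by blast
  have cpoly_linear: "cpoly [:u, v:] x = of_rat u + of_rat v * x" for u v x
    using cpoly_altdef[of "[:u, v:]" 1 x] by simp
  have \<sigma>0: "\<sigma> \<noteq> 0" using \<sigma> D by auto
  have cnj\<sigma>: "cnj \<sigma> = - \<sigma>" by (rule cnj_of_square_negative[OF \<sigma> D])
  have "cnj (\<sigma> * cpoly y z) = cnj w - 1" by (simp add: y)
  then have y': "\<sigma> * cpoly y (cnj z) = 1 - cnj w" by (simp add: cnj\<sigma> cpoly_cnj minus_equation_iff)
  have t': "cpoly t (cnj z) = cnj w + 1" by (simp add: cpoly_cnj t)
  \<comment> \<open>Conjugation negates both \<open>\<sigma>\<close> and \<open>(w + 1)(cnj w - 1)\<close>, so \<open>t(z) cnj (y(z))\<close> is real.\<close>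
  have "\<sigma> * (cpoly t z * cpoly y (cnj z)) = (w + 1) * (1 - cnj w)"
    using y' t by (simp add: mult.left_commute)
  also have "\<dots> = (cnj w + 1) * (w - 1)" using w by (simp add: algebra_simps)
  also have "\<dots> = \<sigma> * (cpoly t (cnj z) * cpoly y z)"
    using y t' by (simp add: mult.left_commute)
  finally have "cpoly t z * cpoly y (cnj z) = cpoly t (cnj z) * cpoly y z" using \<sigma>0 by simp
  \<comment> \<open>The two sides differ by the determinant of the coefficients times
    \<open>z - cnj z\<close>.\<close>
  then have "(of_rat \<beta> * of_rat \<gamma> - of_rat \<alpha> * of_rat \<delta>) * (z - cnj z) = 0"
    unfolding \<alpha>\<beta> \<gamma>\<delta> cpoly_linear by (simp add: algebra_simps)
  with z_nonreal have "of_rat (\<beta> * \<gamma> - \<alpha> * \<delta>) = (0 :: complex)" by (simp add: of_rat_diff of_rat_mult)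
  then have ratio: "\<beta> * \<gamma> = \<alpha> * \<delta>" by simp
  have "\<exists>x. poly t x = 0 \<and> poly y x = 0"
  proof (cases "\<beta> = 0")
    case False
    then show ?thesis using ratio
      by (intro exI[of _ "- \<alpha> / \<beta>"]) (simp add: \<alpha>\<beta> \<gamma>\<delta> field_simps)
  next
    case True
    \<comment> \<open>With \<open>t\<close> constant, \<open>y\<close> must be linear;
      proportionality then gives \<open>t = 0\<close>, and the root of \<open>y\<close>
      serves.\<close>
    have "max (degree t) (degree y) = 1"
      using q degree_sum_of_squares[OF D, of t y] by simp
    with True have "\<delta> \<noteq> 0" by (auto simp: \<alpha>\<beta> \<gamma>\<delta>)
    with True ratio show ?thesis by (intro exI[of _ "- \<gamma> / \<delta>"]) (simp add: \<alpha>\<beta> \<gamma>\<delta>)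
  qed
  then obtain x where "poly t x = 0" "poly y x = 0" by blast
  then have "poly q x = 0" by (simp add: q)
  with no_rat_root[OF irr_q] q(2) show False by simp
qed

section \<open>Excluding k = p and k = 2p\<close>

lemma no_symmetric_solution:
  fixes r y :: "rat poly" and \<epsilon> C :: rat
  assumes p: "prime p" "odd p" "p = 2 * d + 1" "d > 1" and k: "k = p \<or> k = 2 * p"
    and irr: "irreducible r" and root: "cpoly r z = 0" and z: "z \<in> complex_primitive_roots k"
    and r: "degree r = 2 * d" and y: "degree y \<le> d" "rev_poly d y = smult \<epsilon> y"
    and norm: "(monom \<epsilon> d - 1)\<^sup>2 + of_nat D * y\<^sup>2 = smult C r" and D: "D > 0"
    and \<epsilon>: "\<epsilon> = 1 \<and> coprime d k \<or> \<epsilon> = -1 \<and> even k \<and> coprime (d + p) k"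
  shows False
proof -
  have k0: "k > 0" using k p by auto
  have N: "p = (if even k then k div 2 else k)" using k p by auto
  define \<delta> :: rat where "\<delta> = (if even k then -1 else 1)"
  \<comment> \<open>The \<open>p\<close>-th cyclotomic polynomial at \<open>\<delta> * x\<close>: a
    scalar multiple of \<open>r\<close> with explicit values at 0, 1 and -1.\<close>
  define \<Psi> where "\<Psi> = (\<Sum>i<p. monom (\<delta> ^ i) i)"
  have "cpoly \<Psi> z = 0"
    using sum_power_primitive_root[OF z p(1,2) N, of 1, OF _ k0 \<delta>_def]
    by (simp add: \<Psi>_def of_rat_power)
  then have "r dvd \<Psi>" by (rule dvd_of_common_root[OF irr root])
  moreover have "degree \<Psi> \<le> degree r" unfolding \<Psi>_def r
    by (intro degree_sum_le) (use p in \<open>auto intro: order.trans[OF degree_monom_le]\<close>)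
  ultimately obtain c where c: "\<Psi> = smult c r" using dvd_degree_le_imp_smult by blast
  have poly_\<Psi>: "poly \<Psi> x = (\<Sum>i<p. (\<delta> * x) ^ i)" for x
    by (simp add: \<Psi>_def poly_sum poly_monom power_mult_distrib)
  have "poly \<Psi> 0 = 1" using p(3) by (simp add: poly_\<Psi> power_0_left)
  then have "c \<noteq> 0" using c by auto
  define B where "B = C / c"
  have eval: "(\<epsilon> * x ^ d - 1)\<^sup>2 + of_nat D * (poly y x)\<^sup>2 = B * (\<Sum>i<p. (\<delta> * x) ^ i)" for x
    using arg_cong[OF norm, of "\<lambda>f. poly f x"] c \<open>c \<noteq> 0\<close>
    by (simp add: poly_\<Psi>[symmetric] poly_monom B_def)
  have alternating: "(\<Sum>i<p. (-1 :: rat) ^ i) = 1"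
  proof -
    have "(\<Sum>i<Suc (2 * l). (-1 :: rat) ^ i) = 1" for l by (induction l) auto
    with p(3) show ?thesis by simp
  qed
  have y0: "1 + of_nat D * (poly y 0)\<^sup>2 = B" using eval[of 0] p(3,4) by (simp add: power_0_left)
  then have B1: "B \<ge> 1" by (metis le_add_same_cancel1 of_nat_0_le_iff zero_le_power2 zero_le_mult_iff)
  \<comment> \<open>The point -1 is its own reciprocal, so the symmetry of \<open>y\<close>
    restricts its value there.\<close>
  have ym1: "(-1) ^ d * poly y (-1) = \<epsilon> * poly y (-1)"
    using poly_rev_poly[OF y(1), of "-1"] y(2) by auto
  show False
  proof (cases "even k")
    case True
    then have "k = 2 * p" and \<delta>: "\<delta> = -1" using k p by (auto simp: \<delta>_def)
    \<comment> \<open>Coprimality to the even \<open>k\<close> makes \<open>d\<close> odd if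
      \<epsilon> = 1 and even if \<epsilon> = -1. At -1 the norm equation becomes 4 = Bp, impossible
      for \<open>B \<ge> 1\<close> and \<open>p \<ge> 5\<close>.\<close>
    have "\<epsilon> = - ((-1) ^ d)" using \<epsilon> True p(2) by (auto simp: coprime_right_2_iff_odd \<open>k = 2 * p\<close>)
    then have "poly y (-1) = 0" "\<epsilon> * (-1) ^ d = -1" using ym1 by (cases "even d"; simp)+
    then have "4 = B * of_nat p" using eval[of "-1"] by (simp add: \<delta>)
    moreover have "B * of_nat p \<ge> 1 * 5" using B1 p(3,4) by (intro mult_mono) auto
    ultimately show False by simp
  next
    case False
    then have "k = p" and \<delta>: "\<delta> = 1" and \<epsilon>1: "\<epsilon> = 1" using k \<epsilon> by (auto simp: \<delta>_def)
    have e1: "of_nat D * (poly y 1)\<^sup>2 = B * of_nat p" using eval[of 1] by (simp add: \<delta> \<epsilon>1)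
    have em1: "((-1) ^ d - 1)\<^sup>2 + of_nat D * (poly y (-1))\<^sup>2 = B"
      using eval[of "-1"] by (simp add: \<delta> \<epsilon>1 alternating)
    show False
    proof (cases "even d")
      case True
      \<comment> \<open>Eliminating \<open>B\<close> between the values at 1 and -1 would make
        \<open>p\<close> a rational square unless \<open>y\<close> vanishes at -1, which gives
        \<open>B = 0\<close>.\<close>
      then have "of_nat D * (of_nat (p * 1) * (poly y (-1))\<^sup>2) = of_nat D * (poly y 1)\<^sup>2"
        using e1 em1 by (simp add: mult_ac)
      then have "of_nat (p * 1) * (poly y (-1))\<^sup>2 = (poly y 1)\<^sup>2" using D by simp
      then have "poly y (-1) = 0"
        using p prime_mult_square_eq_square[OF p(1), of 1] by auto
      with em1 True B1 show False by simp
    next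
      case False
      then have "poly y (-1) = 0" using ym1 \<epsilon>1 by simp
      with em1 False have "B = 4" by simp
      \<comment> \<open>Here \<open>D * y(0)\<^sup>2 = 3\<close> and
        \<open>D * y(1)\<^sup>2 = 4 * p\<close>. Eliminating \<open>D\<close> would make
        \<open>3 * p\<close> a rational square, as y(0) is nonzero.\<close>
      have "of_nat D * (of_nat (p * 3) * (2 * poly y 0)\<^sup>2)
          = of_nat (p * 12) * (of_nat D * (poly y 0)\<^sup>2)"
        by (simp add: power_mult_distrib)
      also have "\<dots> = 9 * (of_nat D * (poly y 1)\<^sup>2)" using e1 y0 \<open>B = 4\<close> by simp
      also have "\<dots> = of_nat D * (3 * poly y 1)\<^sup>2" by (simp add: power_mult_distrib)
      finally have "of_nat D * (of_nat (p * 3) * (2 * poly y 0)\<^sup>2) = of_nat D * (3 * poly y 1)\<^sup>2" .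
      then have "of_nat (p * 3) * (2 * poly y 0)\<^sup>2 = (3 * poly y 1)\<^sup>2" using D by simp
      moreover have "\<not> p dvd 3" using p(3,4) by (auto dest: dvd_imp_le)
      ultimately have "2 * poly y 0 = 0" by (intro prime_mult_square_eq_square[OF p(1)])
      with y0 \<open>B = 4\<close> show False by simp
    qed
  qed
qed

section \<open>Norm equation and assembly of the cases\<close>

theorem theorem1p2:
  fixes k m n p D :: nat
    and t r q :: "rat poly"
  assumes "prime p" and "odd p"
    and "k = 2 ^ m * p ^ n"
    and "D > 0" and "squarefree D"
    and "cyclotomic_family k D t r q"
  shows "rho_value t r q \<noteq> 1"
proof
  assume rho: "rho_value t r q = 1"
  note p = \<open>prime p\<close> \<open>odd p\<close> and k = \<open>k = 2 ^ m * p ^ n\<close> and D = \<open>D > 0\<close>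
  have k0: "k > 0" using k prime_gt_0_nat[OF p(1)] by simp
  obtain \<eta> s y where bw: "brezing_weng k D \<eta> s t y q"
    using assms(6) by (auto simp: cyclotomic_family_def)
  have r: "r = cyclotomic_poly k" and irr: "irreducible r" and deg_r: "degree r > 0"
    and dvd: "r dvd q + 1 - t"
    using assms(6) by (auto simp: cyclotomic_family_def complete_family_def represents_primes_def)
  have q: "q = smult (1 / 4) (t\<^sup>2 + of_nat D * y\<^sup>2)" and irr_q: "irreducible q"
    using bw by (auto simp: brezing_weng_def Let_def represents_primes_def)
  define d where "d = max (degree t) (degree y)"
  have deg_q: "degree q = 2 * d" using degree_sum_of_squares[OF D] by (simp add: q d_def)
  with rho deg_r have deg: "degree r = 2 * d"
    by (simp add: rho_value_def divide_eq_1_iff)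
  have d0: "d > 0" using deg deg_r by simp
  have "degree (q + 1 - t) \<le> degree r"
    using deg deg_q by (intro degree_diff_le degree_add_le) (auto simp: d_def)
  with dvd obtain c where c: "q + 1 - t = smult c r" using dvd_degree_le_imp_smult by blast
  define C where "C = 4 * c"
  \<comment> \<open>Completing the square in \<open>t\<close> after inserting the definition of
    \<open>q\<close>.\<close>
  have "(t - 2)\<^sup>2 + of_nat D * y\<^sup>2 = smult 4 (q + 1 - t)"
    by (simp add: q power2_eq_square algebra_simps smult_diff_right smult_add_right numeral_poly)
  then have norm: "(t - 2)\<^sup>2 + of_nat D * y\<^sup>2 = smult C r" by (simp add: c C_def)
  have C0: "C \<noteq> 0"
  proof
    assume "C = 0"
    with norm degree_sum_of_squares[OF D, of "t - 2" y] have "degree (t - 2) = 0" "degree y = 0"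
      by simp_all
    then have "degree t \<le> 0" using degree_add_le[of "t - 2" 0 2] by simp
    with \<open>degree y = 0\<close> d0 show False by (simp add: d_def)
  qed
  have "card (complex_primitive_roots k) > 0" using deg_r r degree_cyclotomic_poly[OF k0] by simp
  then obtain z where z: "z \<in> complex_primitive_roots k" by (metis card_gt_0_iff ex_in_conv)
  have root: "cpoly r z = 0" using z k0 by (simp add: r cyclotomic_root_iff)
  have unit: "w * cnj w = 1" if "w ^ k = 1" for w :: complex
    using power_eq_1_iff[OF that] k0 by (simp flip: complex_norm_square)
  have zk: "z ^ k = 1" using z by (simp add: complex_primitive_roots_def)
  obtain a \<sigma> where a: "coprime a k" "a < k" and \<sigma>: "\<sigma>\<^sup>2 = - of_nat D"
    and t: "cpoly t z = z ^ a + 1" and y: "\<sigma> * cpoly y z = z ^ a - 1"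
    using brezing_weng_complex[OF bw k0 D irr[unfolded r] z] by metis
  have dt: "degree t \<le> d" and dy: "degree y \<le> d" by (simp_all add: d_def)
  show False
  proof (cases "d = 1")
    case True
    have "(z ^ a) ^ k = 1" using zk by (metis mult.commute power_mult power_one)
    then show False
      using quadratic_family_not_irreducible[OF irr _ root unit[OF zk] unit \<sigma> D _ t _ y q] True deg deg_q dt dy irr_q
      by simp
  next
    case False
    with d0 have d1: "d > 1" by simp
    have "complex_primitive_roots 1 = {1}" by (auto simp: complex_primitive_roots_def)
    \<comment> \<open>For \<open>k = 1\<close> the degree of \<open>r\<close> would be 1, not
      \<open>2 * d\<close>.\<close>
    then have "k \<noteq> 1" using deg r degree_cyclotomic_poly[of 1] d1 by auto
    then have tot: "totient k = 2 * d"
      using degree_cyclotomic_poly_totient[OF z] k0 deg r by simp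
    define N where "N = (if even k then k div 2 else k)"
    obtain b and \<epsilon> :: rat where b: "0 < b" "b \<le> d" and shape: "t = monom \<epsilon> b + 1"
      and \<epsilon>: "\<epsilon> = 1 \<and> coprime b k \<or> \<epsilon> = -1 \<and> even k \<and> coprime (b + N) k"
      using trace_shape[OF irr[unfolded r] z k0 p k tot deg[unfolded r] d1 a dt t]
      unfolding N_def by metis
    have T: "t - 2 = monom \<epsilon> b - 1" by (simp add: shape)
    have \<epsilon>2: "\<epsilon>\<^sup>2 = 1" using \<epsilon> by auto
    have "z ^ a = of_rat \<epsilon> * z ^ b" using t by (simp add: shape)
    then have y': "\<sigma> * cpoly y z = of_rat \<epsilon> * z ^ b - 1" using y by simp
    note rev = rev_poly_of_norm_equation[OF irr root unit[OF zk] deg dy b \<epsilon>2 \<sigma> D y'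
        norm[unfolded T] C0]
    from p k tot d1 show False
    proof (cases rule: prime_power_totient_half)
      case 1
      \<comment> \<open>With \<open>b = d\<close>, the exponent coprime to \<open>k\<close> is
        \<open>d\<close> or \<open>d + N\<close>; both are even, and so is \<open>k\<close>.\<close>
      then have "2 dvd d + N" by (simp add: N_def)
      with 1 \<epsilon> have "is_unit (2 :: nat)" unfolding rev(1) by (meson coprime_common_divisor)
      then show False by simp
    next
      case (2 M)
      \<comment> \<open>The same argument with \<open>M\<close> in place of 2 gives
        \<open>M = 1\<close>, leaving \<open>k = p\<close> or \<open>k = 2 * p\<close>.\<close>
      then have "M dvd d + N" by (simp add: N_def)
      with 2 \<epsilon> have "is_unit M" unfolding rev(1) by (meson coprime_common_divisor)
      then have M: "M = 1" by simp
      then have "N = p" using 2 by (simp add: N_def)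
      have "p = 2 * d + 1" using 2(3) M prime_gt_0_nat[OF p(1)] by simp
      then show False
        using no_symmetric_solution[OF p _ d1 2(7)[OF M] irr root z deg dy rev(2)
            norm[unfolded T rev(1)] D] \<epsilon> \<open>N = p\<close> unfolding rev(1) by simp
    qed
  qed
qed

end
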